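(* Let $R$ and $S$ be hyperrings and let $f:R\to S$ be a homomorphism. Then the following hold. (1) Suppose $f$ is a surjective good homomorphism and $I$ is a $C_u$-ideal of $R$ such that $\mathrm{Ker} f\subseteq I$. If $I$ is a primary hyperideal of $R$, then $f(I)$ is a primary hyperideal of $S$. (2) If $f$ is a good homomorphism and $J$ is a primary hyperideal of $S$, then $f^{-1}(J)$ is a primary hyperideal of $R$.
   Context: A hyperoperation on a set $R$ is a map $\cdot:R\times R\to P^*(R)$, where $P^*(R)$ is the set of nonempty subsets of $R$. For subsets $A,B$ of $R$ and $a\in R$, $A\cdot B=\bigcup_{x\in A,y\in B}x\cdot y$ and $a\cdot B=\{a\}\cdot B$; longer products are formed in the same way, and $x^n$ is the $n$-fold hyperproduct ($x^1=\{x\}$). Juxtaposition denotes $\cdot$. A multiplicative hyperring $(R,+,\cdot)$ consists of an abelian group $(R,+)$ and an associative hyperoperation $\cdot$ such that for all $x,y,z$: $x\cdot(y+z)\subseteq x\cdot y+x\cdot z$, $(y+z)\cdot x\subseteq y\cdot x+z\cdot x$, and $x\cdot(-y)=(-x)\cdot y=-(x\cdot y)$ (sums and negatives of sets are elementwise). "Hyperring" means a multiplicative hyperring that is commutative ($x\cdot y=y\cdot x$), proper (it is not a ring, i.e. some $x\cdot y$ is not a singleton), and has absorbing zero ($0\in x\cdot 0=0\cdot x$ for all $x$). A hyperideal of $R$ is a nonempty subset $I$ with $x-y\in I$ and $r\cdot x\subseteq I$ for all $x,y\in I$, $r\in R$. The radical is $\sqrt I=\{r\in R: r^n\subseteq I\text{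 for some integer }n\ge1\}$. A proper hyperideal $Q$ ($Q\neq R$) is primary if for all $x,y\in R$, $x\cdot y\subseteq Q$ implies $x\in Q$ or $y\in\sqrt Q$. Let $C$ be the class of all finite hyperproducts $r_1\cdot r_2\cdots r_n$ of elements of $R$ with $n\ge 2$. A hyperideal $I$ of $R$ is a $C_u$-ideal ($C$-union ideal) if for any family $(A_j)$ of members of $C$, $(\bigcup_j A_j)\cap I\neq\varnothing$ implies $\bigcup_j A_j\subseteq I$. A map $f:R\to S$ of hyperrings is a homomorphism if $f(x+y)=f(x)+f(y)$ and $f(x\cdot y)\subseteq f(x)\cdot f(y)$ for all $x,y\in R$; it is a good homomorphism if moreover $f(x\cdot y)=f(x)\cdot f(y)$. $\mathrm{Ker} f=f^{-1}(\langle 0\rangle)$, where $\langle 0\rangle$ is the hyperideal of $S$ generated by $0$, i.e. the set of all finite sums $\sum_i x_i+\sum_j y_j+\sum_k z_k$ with $x_i\in r_i\cdot 0$, $y_j\in 0\cdot s_j$, $z_k\in t_k\cdot 0\cdot u_k$ for some $r_i,s_j,t_k,u_k\in S$ (it may contain more than $0$).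
   Formalization: Part (2) additionally assumes that $f^{-1}(J)\neq R$; without it the claim fails, e.g. for $R=S=\mathbb{Z}$ with $x\cdot y=\{2xy,3xy\}$, $f=0$, $J=5\mathbb{Z}$, where $f^{-1}(J)=R$ is not proper and hence not primary. *)

theory Defs
  imports "HOL-Algebra.AbelCoset" "HOL.Hull"
begin

text \<open>
  The additive structure is the \<open>abelian_group\<close> of HOL-Algebra, which is formulated for extensions of
  the record \<open>ring\<close>. The inherited fields \<open>mult\<close> and \<open>one\<close> are neither constrained nor used: the
  multiplication is the set-valued field \<open>hmult\<close>, and no identity is assumed.
\<close>

record 'a hyperring = "'a ring" +
  hmult :: "'a \<Rightarrow> 'a \<Rightarrow> 'a set"  (infixl "\<star>\<index>" 70)

definition hset_mult :: "('a, 'm) hyperring_scheme \<Rightarrow> 'a set \<Rightarrow> 'a set \<Rightarrow> 'a set"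
    (infixl "<\<star>>\<index>" 70) where
  "A <\<star>>\<^bsub>R\<^esub> B = (\<Union>x\<in>A. \<Union>y\<in>B. x \<star>\<^bsub>R\<^esub> y)"

locale multiplicative_hyperring = abelian_group R for R :: "('a, 'm) hyperring_scheme" (structure) +
  assumes hmult_closed: "\<lbrakk>x \<in> carrier R; y \<in> carrier R\<rbrakk> \<Longrightarrow> x \<star> y \<subseteq> carrier R"
    and hmult_nonempty: "\<lbrakk>x \<in> carrier R; y \<in> carrier R\<rbrakk> \<Longrightarrow> x \<star> y \<noteq> {}"
    and hmult_assoc: "\<lbrakk>x \<in> carrier R; y \<in> carrier R; z \<in> carrier R\<rbrakk>
          \<Longrightarrow> (x \<star> y) <\<star>> {z} = {x} <\<star>> (y \<star> z)"
    and hmult_add_right: "\<lbrakk>x \<in> carrier R; y \<in> carrier R; z \<in> carrier R\<rbrakk>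
          \<Longrightarrow> x \<star> (y \<oplus> z) \<subseteq> (x \<star> y) <+> (x \<star> z)"
    and hmult_add_left: "\<lbrakk>x \<in> carrier R; y \<in> carrier R; z \<in> carrier R\<rbrakk>
          \<Longrightarrow> (y \<oplus> z) \<star> x \<subseteq> (y \<star> x) <+> (z \<star> x)"
    and hmult_minus_right: "\<lbrakk>x \<in> carrier R; y \<in> carrier R\<rbrakk>
          \<Longrightarrow> x \<star> (\<ominus> y) = (\<lambda>z. \<ominus> z) ` (x \<star> y)"
    and hmult_minus_left: "\<lbrakk>x \<in> carrier R; y \<in> carrier R\<rbrakk>
          \<Longrightarrow> (\<ominus> x) \<star> y = (\<lambda>z. \<ominus> z) ` (x \<star> y)"

locale hyperring = multiplicative_hyperring +
  assumes hmult_comm: "\<lbrakk>x \<in> carrier R; y \<in> carrier R\<rbrakk> \<Longrightarrow> x \<star> y = y \<star> x"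
    and not_ring: "\<exists>x\<in>carrier R. \<exists>y\<in>carrier R. \<not> is_singleton (x \<star> y)"
    and zero_absorbing: "x \<in> carrier R \<Longrightarrow> \<zero> \<in> x \<star> \<zero> \<and> x \<star> \<zero> = \<zero> \<star> x"

text \<open>
  The hyperproduct of a list of factors; the value on the empty list is a dummy, since every use
  below involves at least one factor.
\<close>

fun hprod :: "('a, 'm) hyperring_scheme \<Rightarrow> 'a list \<Rightarrow> 'a set" where
  "hprod R [] = {}"
| "hprod R [x] = {x}"
| "hprod R (x # y # zs) = {x} <\<star>>\<^bsub>R\<^esub> hprod R (y # zs)"

definition hpow :: "('a, 'm) hyperring_scheme \<Rightarrow> 'a \<Rightarrow> nat \<Rightarrow> 'a set" where
  "hpow R x n = hprod R (replicate n x)"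

definition hyperideal :: "('a, 'm) hyperring_scheme \<Rightarrow> 'a set \<Rightarrow> bool" where
  "hyperideal R I \<longleftrightarrow> I \<subseteq> carrier R \<and> I \<noteq> {} \<and>
     (\<forall>x\<in>I. \<forall>y\<in>I. x \<ominus>\<^bsub>R\<^esub> y \<in> I) \<and>
     (\<forall>r\<in>carrier R. \<forall>x\<in>I. r \<star>\<^bsub>R\<^esub> x \<subseteq> I)"

definition hyper_radical :: "('a, 'm) hyperring_scheme \<Rightarrow> 'a set \<Rightarrow> 'a set" where
  "hyper_radical R I = {r \<in> carrier R. \<exists>n\<ge>1. hpow R r n \<subseteq> I}"

definition primary_hyperideal :: "('a, 'm) hyperring_scheme \<Rightarrow> 'a set \<Rightarrow> bool" where
  "primary_hyperideal R Q \<longleftrightarrow> hyperideal R Q \<and> Q \<noteq> carrier R \<and>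
     (\<forall>x\<in>carrier R. \<forall>y\<in>carrier R. x \<star>\<^bsub>R\<^esub> y \<subseteq> Q \<longrightarrow> x \<in> Q \<or> y \<in> hyper_radical R Q)"

text \<open>
  Primary hyperideals are proper, whereas the preimage of a proper hyperideal under a good homomorphism
  need not be: if \<open>\<zero> \<star> \<zero> = {\<zero>}\<close> in the target, then the zero map is a good homomorphism, and
  the preimage of every hyperideal under it is the whole source. A statement that a preimage is primary
  therefore has to exclude the case that it is the whole carrier.
\<close>

definition finite_hyperproducts :: "('a, 'm) hyperring_scheme \<Rightarrow> 'a set set" where
  "finite_hyperproducts R = {hprod R rs | rs. set rs \<subseteq> carrier R \<and> 2 \<le> length rs}"

definition C_union_ideal :: "('a, 'm) hyperring_scheme \<Rightarrow> 'a set \<Rightarrow> bool" where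
  "C_union_ideal R I \<longleftrightarrow> hyperideal R I \<and>
     (\<forall>\<A>\<subseteq>finite_hyperproducts R. \<Union>\<A> \<inter> I \<noteq> {} \<longrightarrow> \<Union>\<A> \<subseteq> I)"

definition hyperring_hom :: "('a, 'm) hyperring_scheme \<Rightarrow> ('b, 'n) hyperring_scheme \<Rightarrow> ('a \<Rightarrow> 'b) set" where
  "hyperring_hom R S = {f. f \<in> carrier R \<rightarrow> carrier S \<and>
     (\<forall>x\<in>carrier R. \<forall>y\<in>carrier R. f (x \<oplus>\<^bsub>R\<^esub> y) = f x \<oplus>\<^bsub>S\<^esub> f y) \<and>
     (\<forall>x\<in>carrier R. \<forall>y\<in>carrier R. f ` (x \<star>\<^bsub>R\<^esub> y) \<subseteq> f x \<star>\<^bsub>S\<^esub> f y)}"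

definition good_hyperring_hom :: "('a, 'm) hyperring_scheme \<Rightarrow> ('b, 'n) hyperring_scheme \<Rightarrow> ('a \<Rightarrow> 'b) set" where
  "good_hyperring_hom R S = {f \<in> hyperring_hom R S.
     \<forall>x\<in>carrier R. \<forall>y\<in>carrier R. f ` (x \<star>\<^bsub>R\<^esub> y) = f x \<star>\<^bsub>S\<^esub> f y}"

definition zero_hyperideal :: "('a, 'm) hyperring_scheme \<Rightarrow> 'a set" where
  "zero_hyperideal R = hyperideal R hull {\<zero>\<^bsub>R\<^esub>}"

definition hyper_kernel :: "('a, 'm) hyperring_scheme \<Rightarrow> ('b, 'n) hyperring_scheme \<Rightarrow> ('a \<Rightarrow> 'b) \<Rightarrow> 'a set" where
  "hyper_kernel R S f = {x \<in> carrier R. f x \<in> zero_hyperideal S}"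

text \<open>
  The hyperideal generated by \<open>\<zero>\<close> consists of the finite sums of elements of the sets \<open>r \<star> \<zero>\<close>,
  \<open>\<zero> \<star> s\<close> and \<open>t \<star> \<zero> \<star> u\<close>; it may be larger than \<open>{\<zero>}\<close>.
\<close>

context hyperring
begin

definition zero_summands :: "'a set" where
  "zero_summands = (\<Union>r\<in>carrier R. r \<star> \<zero>) \<union> (\<Union>s\<in>carrier R. \<zero> \<star> s) \<union>
     (\<Union>t\<in>carrier R. \<Union>u\<in>carrier R. (t \<star> \<zero>) <\<star>> {u})"

lemma zero_summands_eq: "zero_summands = (\<Union>r\<in>carrier R. r \<star> \<zero>)"
proof -
  have "\<exists>r\<in>carrier R. x \<in> r \<star> \<zero>"
    if t: "t \<in> carrier R" and u: "u \<in> carrier R" and x: "x \<in> (t \<star> \<zero>) <\<star>> {u}" for x t u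
  proof -
    have "(t \<star> \<zero>) <\<star>> {u} = {t} <\<star>> (\<zero> \<star> u)" using t u by (intro hmult_assoc) auto
    also have "\<zero> \<star> u = u \<star> \<zero>" using u by (intro hmult_comm) auto
    also have "{t} <\<star>> (u \<star> \<zero>) = (t \<star> u) <\<star>> {\<zero>}" using t u by (intro hmult_assoc[symmetric]) auto
    finally have "x \<in> (t \<star> u) <\<star>> {\<zero>}" using x by simp
    then obtain q where "q \<in> t \<star> u" "x \<in> q \<star> \<zero>" by (auto simp: hset_mult_def)
    then show ?thesis using hmult_closed[OF t u] by blast
  qed
  then have "(\<Union>t\<in>carrier R. \<Union>u\<in>carrier R. (t \<star> \<zero>) <\<star>> {u}) \<subseteq> (\<Union>r\<in>carrier R. r \<star> \<zero>)"
    by (force simp: subset_iff)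
  moreover have "(\<Union>s\<in>carrier R. \<zero> \<star> s) = (\<Union>r\<in>carrier R. r \<star> \<zero>)"
    using hmult_comm by (intro SUP_cong) auto
  ultimately show ?thesis unfolding zero_summands_def by (simp only: Un_absorb Un_absorb2)
qed

lemma zero_summands_closed: "zero_summands \<subseteq> carrier R"
  unfolding zero_summands_eq using hmult_closed by blast

lemma zero_summands_mult:
  assumes r: "r \<in> carrier R" and x: "x \<in> zero_summands"
  shows "r \<star> x \<subseteq> zero_summands"
proof -
  obtain q where q: "q \<in> carrier R" "x \<in> q \<star> \<zero>" using x unfolding zero_summands_eq by blast
  then have "r \<star> x \<subseteq> {r} <\<star>> (q \<star> \<zero>)" by (auto simp: hset_mult_def)
  also have "\<dots> = (r \<star> q) <\<star>> {\<zero>}" using r q by (intro hmult_assoc[symmetric]) auto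
  finally show ?thesis
    using hmult_closed[OF r q(1)] unfolding zero_summands_eq hset_mult_def by blast
qed

lemma zero_summands_minus: "x \<in> zero_summands \<Longrightarrow> \<ominus> x \<in> zero_summands"
proof -
  assume "x \<in> zero_summands"
  then obtain q where q: "q \<in> carrier R" "x \<in> q \<star> \<zero>" unfolding zero_summands_eq by blast
  then have "\<ominus> x \<in> (\<ominus> q) \<star> \<zero>" using hmult_minus_left[OF q(1) zero_closed] by blast
  then show ?thesis using q(1) unfolding zero_summands_eq by blast
qed

lemma foldr_add_closed: "set xs \<subseteq> carrier R \<Longrightarrow> foldr (\<oplus>) xs \<zero> \<in> carrier R"
  by (induction xs) auto

lemma foldr_add_append:
  "set xs \<subseteq> carrier R \<Longrightarrow> set ys \<subseteq> carrier R \<Longrightarrow>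
     foldr (\<oplus>) (xs @ ys) \<zero> = foldr (\<oplus>) xs \<zero> \<oplus> foldr (\<oplus>) ys \<zero>"
  by (induction xs) (auto simp: foldr_add_closed a_assoc simp del: foldr_append)

lemma foldr_add_minus:
  "set xs \<subseteq> carrier R \<Longrightarrow> \<ominus> foldr (\<oplus>) xs \<zero> = foldr (\<oplus>) (map (\<lambda>x. \<ominus> x) xs) \<zero>"
  by (induction xs) (auto simp: foldr_add_closed minus_add)

lemma foldr_add_mult:
  assumes "r \<in> carrier R" and "set xs \<subseteq> zero_summands" and "z \<in> r \<star> foldr (\<oplus>) xs \<zero>"
  shows "\<exists>ys. set ys \<subseteq> zero_summands \<and> z = foldr (\<oplus>) ys \<zero>"
  using assms(2,3)
proof (induction xs arbitrary: z)
  case Nil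
  then have z: "z \<in> zero_summands" using assms(1) unfolding zero_summands_eq by auto
  then have "z = foldr (\<oplus>) [z] \<zero>" using zero_summands_closed by auto
  then show ?case using z by (intro exI[of _ "[z]"]) auto
next
  case (Cons a xs)
  have "z \<in> (r \<star> a) <+> (r \<star> foldr (\<oplus>) xs \<zero>)"
    using Cons.prems hmult_add_right[OF assms(1), of a "foldr (\<oplus>) xs \<zero>"]
      foldr_add_closed[of xs] zero_summands_closed by auto
  then obtain u v where uv: "u \<in> r \<star> a" "v \<in> r \<star> foldr (\<oplus>) xs \<zero>" "z = u \<oplus> v"
    unfolding set_add_def' by blast
  then obtain ys where ys: "set ys \<subseteq> zero_summands" "v = foldr (\<oplus>) ys \<zero>"
    using Cons by auto
  have "u \<in> zero_summands" using uv(1) zero_summands_mult[OF assms(1), of a] Cons.prems by auto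
  then show ?case using ys uv by (intro exI[of _ "u # ys"]) auto
qed

lemma zero_hyperideal_eq:
  "zero_hyperideal R = {foldr (\<oplus>) xs \<zero> | xs. set xs \<subseteq> zero_summands}" (is "_ = ?Z")
proof
  have "hyperideal R ?Z"
    unfolding hyperideal_def
  proof (intro conjI ballI)
    show "?Z \<subseteq> carrier R" using foldr_add_closed zero_summands_closed by blast
    show "?Z \<noteq> {}" by (auto intro: exI[of _ "[]"])
  next
    fix x y assume "x \<in> ?Z" "y \<in> ?Z"
    then obtain xs ys where xs: "set xs \<subseteq> zero_summands" "x = foldr (\<oplus>) xs \<zero>"
      and ys: "set ys \<subseteq> zero_summands" "y = foldr (\<oplus>) ys \<zero>" by blast
    let ?m = "map (\<lambda>x. \<ominus> x) ys"
    have m: "set ?m \<subseteq> zero_summands" using ys zero_summands_minus by auto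
    have "x \<ominus> y = foldr (\<oplus>) xs \<zero> \<oplus> foldr (\<oplus>) ?m \<zero>"
      using ys xs foldr_add_minus[of ys] zero_summands_closed by (simp add: a_minus_def)
    also have "\<dots> = foldr (\<oplus>) (xs @ ?m) \<zero>"
      using m xs zero_summands_closed by (intro foldr_add_append[symmetric]) auto
    finally have "x \<ominus> y = foldr (\<oplus>) (xs @ ?m) \<zero>" .
    moreover have "set (xs @ ?m) \<subseteq> zero_summands" using m xs by simp
    ultimately show "x \<ominus> y \<in> ?Z" by blast
  next
    fix r x assume "r \<in> carrier R" "x \<in> ?Z"
    then show "r \<star> x \<subseteq> ?Z" using foldr_add_mult by blast
  qed
  moreover have "\<zero> \<in> ?Z" by (auto intro: exI[of _ "[]"])
  ultimately show "zero_hyperideal R \<subseteq> ?Z"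
    unfolding zero_hyperideal_def by (intro hull_minimal) auto
next
  show "?Z \<subseteq> zero_hyperideal R"
  proof
    fix z assume "z \<in> ?Z"
    then obtain xs where xs: "set xs \<subseteq> zero_summands" "z = foldr (\<oplus>) xs \<zero>" by blast
    have "foldr (\<oplus>) xs \<zero> \<in> I" if I: "hyperideal R I" "\<zero> \<in> I" for I
      using xs(1)
    proof (induction xs)
      case Nil
      then show ?case using I by simp
    next
      case (Cons a xs)
      obtain q where "q \<in> carrier R" "a \<in> q \<star> \<zero>"
        using Cons.prems unfolding zero_summands_eq by auto
      then have a: "a \<in> I" using I unfolding hyperideal_def by blast
      have Is: "I \<subseteq> carrier R" and d: "\<And>x y. x \<in> I \<Longrightarrow> y \<in> I \<Longrightarrow> x \<ominus> y \<in> I"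
        using I unfolding hyperideal_def by auto
      have s: "foldr (\<oplus>) xs \<zero> \<in> I" using Cons by auto
      then have "a \<ominus> (\<zero> \<ominus> foldr (\<oplus>) xs \<zero>) \<in> I" using d a I(2) by blast
      moreover have "a \<ominus> (\<zero> \<ominus> foldr (\<oplus>) xs \<zero>) = a \<oplus> foldr (\<oplus>) xs \<zero>"
        using s a Is by (auto simp: a_minus_def subset_iff)
      ultimately show ?case by simp
    qed
    then show "z \<in> zero_hyperideal R"
      unfolding zero_hyperideal_def hull_def xs(2) by simp
  qed
qed

end

end

theory Submission
  imports Defs
begin

text \<open>
  Since a good homomorphism \<open>f\<close> satisfies \<open>f (x \<cdot> y) = f x \<cdot> f y\<close> with equality, it maps every
  finite hyperproduct onto the hyperproduct of the images. Consequently a hyperproduct of images lies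
  in a set \<open>J\<close> exactly when the original hyperproduct lies in \<open>f\<^sup>-\<^sup>1 J\<close>
  (\<open>image_hprod_subset_iff\<close>), so that both ingredients of primariness, the condition on products of two
  elements and membership in the radical, can be read off equivalently upstairs and downstairs.
  This gives the statement on proper preimages directly, and for surjective \<open>f\<close> it also
  yields the converse: a hyperideal \<open>J\<close> of \<open>S\<close> is primary as soon as \<open>f\<^sup>-\<^sup>1 J\<close> is.

  The statement on images is this converse applied to \<open>J = f I\<close>: two elements with the same image differ
  by an element of the kernel, so a hyperideal \<open>I\<close> that contains the kernel is saturated,
  \<open>f\<^sup>-\<^sup>1 (f I) = I\<close> (\<open>preimage_image\<close>).
\<close>

lemma (in multiplicative_hyperring) hyperideal_zero: "hyperideal R I \<Longrightarrow> \<zero> \<in> I"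
proof -
  assume I: "hyperideal R I"
  then obtain x where x: "x \<in> I" unfolding hyperideal_def by blast
  then have "x \<ominus> x \<in> I" and "x \<in> carrier R" using I by (auto simp: hyperideal_def)
  then show "\<zero> \<in> I" by (simp add: minus_eq r_neg)
qed

lemma (in multiplicative_hyperring) hyperideal_add:
  assumes I: "hyperideal R I" and x: "x \<in> I" and y: "y \<in> I"
  shows "x \<oplus> y \<in> I"
proof -
  have d: "\<And>u v. u \<in> I \<Longrightarrow> v \<in> I \<Longrightarrow> u \<ominus> v \<in> I" and c: "x \<in> carrier R" "y \<in> carrier R"
    using I x y unfolding hyperideal_def by auto
  have "x \<ominus> (\<zero> \<ominus> y) \<in> I" using d x y hyperideal_zero[OF I] by blast
  then show ?thesis using c by (simp add: minus_eq)
qed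

lemma (in multiplicative_hyperring) hprod_closed:
  "set xs \<subseteq> carrier R \<Longrightarrow> hprod R xs \<subseteq> carrier R"
proof (induction xs rule: induct_list012)
  case (3 x y zs)
  then have "hprod R (y # zs) \<subseteq> carrier R" and "x \<in> carrier R" by auto
  then have "x \<star> z \<subseteq> carrier R" if "z \<in> hprod R (y # zs)" for z
    using that hmult_closed by blast
  then show ?case by (auto simp: hset_mult_def)
qed auto

locale good_hom = R: hyperring R + S: hyperring S
  for R :: "('a, 'm) hyperring_scheme" (structure) and S :: "('b, 'n) hyperring_scheme" (structure) +
  fixes f :: "'a \<Rightarrow> 'b"
  assumes good: "f \<in> good_hyperring_hom R S"
begin

lemma closed: "x \<in> carrier R \<Longrightarrow> f x \<in> carrier S"
  and add: "x \<in> carrier R \<Longrightarrow> y \<in> carrier R \<Longrightarrow> f (x \<oplus>\<^bsub>R\<^esub> y) = f x \<oplus>\<^bsub>S\<^esub> f y"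
  and hmult: "x \<in> carrier R \<Longrightarrow> y \<in> carrier R \<Longrightarrow> f ` (x \<star>\<^bsub>R\<^esub> y) = f x \<star>\<^bsub>S\<^esub> f y"
  using good unfolding good_hyperring_hom_def hyperring_hom_def by auto

sublocale additive: abelian_group_hom R S f
  by (intro abelian_group_homI R.abelian_group_axioms S.abelian_group_axioms
      group_hom.intro group_hom_axioms.intro R.a_group S.a_group)
     (auto simp: hom_def closed add)

lemma diff: "x \<in> carrier R \<Longrightarrow> y \<in> carrier R \<Longrightarrow> f (x \<ominus>\<^bsub>R\<^esub> y) = f x \<ominus>\<^bsub>S\<^esub> f y"
  by (simp add: a_minus_def add)

lemma image_hprod: "set xs \<subseteq> carrier R \<Longrightarrow> f ` hprod R xs = hprod S (map f xs)"
proof (induction xs rule: induct_list012)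
  case (3 x y zs)
  have sub: "hprod R (y # zs) \<subseteq> carrier R" using "3.prems" by (intro R.hprod_closed) auto
  have "f ` hprod R (x # y # zs) = (\<Union>z\<in>hprod R (y # zs). f ` (x \<star>\<^bsub>R\<^esub> z))"
    by (auto simp: hset_mult_def)
  also have "\<dots> = (\<Union>z\<in>hprod R (y # zs). f x \<star>\<^bsub>S\<^esub> f z)"
    using sub "3.prems" by (intro SUP_cong refl hmult) auto
  also have "\<dots> = {f x} <\<star>>\<^bsub>S\<^esub> (f ` hprod R (y # zs))" by (simp add: hset_mult_def)
  also have "\<dots> = hprod S (map f (x # y # zs))" using 3 by simp
  finally show ?case .
qed auto

lemma image_hprod_subset_iff:
  assumes "set xs \<subseteq> carrier R"
  shows "hprod S (map f xs) \<subseteq> J \<longleftrightarrow> hprod R xs \<subseteq> f -` J \<inter> carrier R"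
  using R.hprod_closed[OF assms]
  by (simp add: image_hprod[OF assms, symmetric] image_subset_iff_subset_vimage)

lemma hmult_subset_iff:
  assumes "x \<in> carrier R" "y \<in> carrier R"
  shows "f x \<star>\<^bsub>S\<^esub> f y \<subseteq> J \<longleftrightarrow> x \<star>\<^bsub>R\<^esub> y \<subseteq> f -` J \<inter> carrier R"
  using image_hprod_subset_iff[of "[x, y]" J] assms by (simp add: hset_mult_def)

lemma radical_iff:
  assumes "x \<in> carrier R"
  shows "f x \<in> hyper_radical S J \<longleftrightarrow> x \<in> hyper_radical R (f -` J \<inter> carrier R)"
proof -
  have "hpow S (f x) n \<subseteq> J \<longleftrightarrow> hpow R x n \<subseteq> f -` J \<inter> carrier R" for n
    using image_hprod_subset_iff[of "replicate n x" J] assms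
    by (auto simp: hpow_def set_replicate_conv_if)
  then show ?thesis using assms closed by (simp add: hyper_radical_def)
qed

lemma hyperideal_preimage:
  assumes J: "hyperideal S J"
  shows "hyperideal R (f -` J \<inter> carrier R)"
  unfolding hyperideal_def
proof (intro conjI ballI)
  show "f -` J \<inter> carrier R \<noteq> {}"
  proof -
    have "\<zero>\<^bsub>R\<^esub> \<in> f -` J \<inter> carrier R" using S.hyperideal_zero[OF J] additive.hom_zero by simp
    then show ?thesis by blast
  qed
next
  fix x y assume "x \<in> f -` J \<inter> carrier R" "y \<in> f -` J \<inter> carrier R"
  then show "x \<ominus>\<^bsub>R\<^esub> y \<in> f -` J \<inter> carrier R"
    using J by (auto simp: diff hyperideal_def)
next
  fix r x assume r: "r \<in> carrier R" and x: "x \<in> f -` J \<inter> carrier R"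
  have "f r \<star>\<^bsub>S\<^esub> f x \<subseteq> J" using J r x closed by (simp add: hyperideal_def)
  then show "r \<star>\<^bsub>R\<^esub> x \<subseteq> f -` J \<inter> carrier R" using r x hmult_subset_iff by blast
qed auto

lemma hyperideal_image:
  assumes surj: "f ` carrier R = carrier S" and I: "hyperideal R I"
  shows "hyperideal S (f ` I)"
  unfolding hyperideal_def
proof (intro conjI ballI)
  have sub: "I \<subseteq> carrier R" using I by (simp add: hyperideal_def)
  show "f ` I \<subseteq> carrier S" using sub closed by auto
  show "f ` I \<noteq> {}" using I by (simp add: hyperideal_def)
  fix x' assume "x' \<in> f ` I"
  then obtain x where x: "x \<in> I" "x' = f x" by blast
  {
    fix y' assume "y' \<in> f ` I"
    then obtain y where y: "y \<in> I" "y' = f y" by blast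
    have "x' \<ominus>\<^bsub>S\<^esub> y' = f (x \<ominus>\<^bsub>R\<^esub> y)" using x y sub by (simp add: diff subset_iff)
    then show "x' \<ominus>\<^bsub>S\<^esub> y' \<in> f ` I" using I x y by (simp add: hyperideal_def)
  next
    fix r' assume "r' \<in> carrier S"
    then obtain r where r: "r \<in> carrier R" "r' = f r" using surj by blast
    have "r' \<star>\<^bsub>S\<^esub> x' = f ` (r \<star>\<^bsub>R\<^esub> x)" using r x sub by (simp add: hmult subset_iff)
    then show "r' \<star>\<^bsub>S\<^esub> x' \<subseteq> f ` I" using I r x by (simp add: hyperideal_def image_mono)
  }
qed

text \<open>
  If \<open>f x = f i\<close> with \<open>i \<in> I\<close>, then \<open>x - i\<close> is sent to \<open>\<zero>\<close> and hence lies in the kernel, so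
  \<open>x = (x - i) + i\<close> lies in \<open>I\<close>.
\<close>

lemma preimage_image:
  assumes I: "hyperideal R I" and ker: "hyper_kernel R S f \<subseteq> I"
  shows "f -` (f ` I) \<inter> carrier R = I"
proof
  have sub: "I \<subseteq> carrier R" using I by (simp add: hyperideal_def)
  then show "I \<subseteq> f -` (f ` I) \<inter> carrier R" by auto
  show "f -` (f ` I) \<inter> carrier R \<subseteq> I"
  proof
    fix x assume "x \<in> f -` (f ` I) \<inter> carrier R"
    then obtain i where x: "x \<in> carrier R" and i: "i \<in> I" "f x = f i" by auto
    have ic: "i \<in> carrier R" using i sub by auto
    have "f (x \<ominus>\<^bsub>R\<^esub> i) = \<zero>\<^bsub>S\<^esub>" using x ic i closed by (simp add: diff a_minus_def S.r_neg)
    moreover have "\<zero>\<^bsub>S\<^esub> \<in> zero_hyperideal S"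
      unfolding zero_hyperideal_def using hull_subset by fastforce
    ultimately have "x \<ominus>\<^bsub>R\<^esub> i \<in> I" using ker x ic by (auto simp: hyper_kernel_def)
    then have "(x \<ominus>\<^bsub>R\<^esub> i) \<oplus>\<^bsub>R\<^esub> i \<in> I" using I i by (intro R.hyperideal_add)
    then show "x \<in> I" using x ic by (simp add: a_minus_def R.a_assoc R.l_neg)
  qed
qed

lemma primary_preimage:
  assumes J: "primary_hyperideal S J" and proper: "f -` J \<inter> carrier R \<noteq> carrier R"
  shows "primary_hyperideal R (f -` J \<inter> carrier R)"
  unfolding primary_hyperideal_def
proof (intro conjI ballI impI proper)
  show "hyperideal R (f -` J \<inter> carrier R)"
    using J hyperideal_preimage by (simp add: primary_hyperideal_def)
next
  fix x y assume xy: "x \<in> carrier R" "y \<in> carrier R" "x \<star>\<^bsub>R\<^esub> y \<subseteq> f -` J \<inter> carrier R"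
  then have "f x \<star>\<^bsub>S\<^esub> f y \<subseteq> J" by (simp add: hmult_subset_iff)
  then have "f x \<in> J \<or> f y \<in> hyper_radical S J"
    using J xy closed by (simp add: primary_hyperideal_def)
  then show "x \<in> f -` J \<inter> carrier R \<or> y \<in> hyper_radical R (f -` J \<inter> carrier R)"
    using xy radical_iff by auto
qed

text \<open>
  Along a surjection every pair of elements of \<open>S\<close> has preimages in \<open>R\<close>, so primariness of the
  preimage says everything about \<open>J\<close> itself.
\<close>

lemma primary_if_preimage_primary:
  assumes surj: "f ` carrier R = carrier S" and J: "hyperideal S J"
    and prim: "primary_hyperideal R (f -` J \<inter> carrier R)"
  shows "primary_hyperideal S J"
  unfolding primary_hyperideal_def
proof (intro conjI ballI impI J)
  show "J \<noteq> carrier S" using prim closed by (auto simp: primary_hyperideal_def)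
next
  fix x' y' assume xy': "x' \<in> carrier S" "y' \<in> carrier S" "x' \<star>\<^bsub>S\<^esub> y' \<subseteq> J"
  then obtain x y where xy: "x \<in> carrier R" "x' = f x" "y \<in> carrier R" "y' = f y"
    using surj by blast
  then have "x \<star>\<^bsub>R\<^esub> y \<subseteq> f -` J \<inter> carrier R" using xy' hmult_subset_iff by simp
  then have "x \<in> f -` J \<or> y \<in> hyper_radical R (f -` J \<inter> carrier R)"
    using prim xy by (auto simp: primary_hyperideal_def)
  then show "x' \<in> J \<or> y' \<in> hyper_radical S J" using xy radical_iff by auto
qed

end

theorem theorem2p14:
  fixes R :: "('a, 'm) hyperring_scheme" and S :: "('b, 'n) hyperring_scheme"
    and f :: "'a \<Rightarrow> 'b"
  assumes "hyperring R" and "hyperring S" and "f \<in> hyperring_hom R S"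
  shows "(\<forall>I. f \<in> good_hyperring_hom R S \<longrightarrow> f ` carrier R = carrier S \<longrightarrow>
            C_union_ideal R I \<longrightarrow> hyper_kernel R S f \<subseteq> I \<longrightarrow>
            primary_hyperideal R I \<longrightarrow> primary_hyperideal S (f ` I))
       \<and> (\<forall>J. f \<in> good_hyperring_hom R S \<longrightarrow> primary_hyperideal S J \<longrightarrow>
            f -` J \<inter> carrier R \<noteq> carrier R \<longrightarrow>
            primary_hyperideal R (f -` J \<inter> carrier R))"
proof (intro conjI allI impI)
  fix I
  assume good: "f \<in> good_hyperring_hom R S" and surj: "f ` carrier R = carrier S"
    and ker: "hyper_kernel R S f \<subseteq> I" and prim: "primary_hyperideal R I"
  interpret good_hom R S f using assms good by (intro good_hom.intro good_hom_axioms.intro)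
  have I: "hyperideal R I" using prim by (simp add: primary_hyperideal_def)
  show "primary_hyperideal S (f ` I)"
    using surj hyperideal_image[OF surj I]
    by (rule primary_if_preimage_primary) (simp add: preimage_image[OF I ker] prim)
next
  fix J
  assume good: "f \<in> good_hyperring_hom R S" and prim: "primary_hyperideal S J"
    and proper: "f -` J \<inter> carrier R \<noteq> carrier R"
  interpret good_hom R S f using assms good by (intro good_hom.intro good_hom_axioms.intro)
  show "primary_hyperideal R (f -` J \<inter> carrier R)" using prim proper by (rule primary_preimage)
qed

end
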